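(* Let $(W,S)$ be a Coxeter system with $S$ finite, and let $\theta:W\to W$ be a group automorphism with $\theta^2=\mathrm{id}$ and $\theta(S)=S$. Let $w\in\mathfrak{I}(\theta)$ and suppose $s\in D_R(w)$. Then the map $v\mapsto v\underline{s}$ is a special matching on the interval $[e,w]$ of $\mathrm{Br}(\mathfrak{I}(\theta))$.
   Context: $e$ is the identity of $W$, $\ell$ the length function, $D_R(w)=\{s\in S\mid \ell(ws)<\ell(w)\}$. $\mathfrak{I}(\theta)=\{w\in W\mid \theta(w)=w^{-1}\}$, and $\mathrm{Br}(\mathfrak{I}(\theta))$ is the subposet of the Bruhat order on $W$ induced on $\mathfrak{I}(\theta)$. For $s\in S$, $\underline{s}$ is a formal symbol acting on the right on $W$ by $v\underline{s}=vs$ if $\theta(s)vs=v$, and $v\underline{s}=\theta(s)vs$ otherwise. A special matching on a poset $Q$ is an involution $M:Q\to Q$ such that for every $x\in Q$ either $x$ covers $M(x)$ or $M(x)$ covers $x$, and such that for all $x,y\in Q$ with $M(x)\neq y$, if $y$ covers $x$ then $M(x)<M(y)$. *)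

theory Defs
  imports "HOL-Algebra.Algebra" "HOL-Library.Extended_Nat"
begin

section \<open>Coxeter systems\<close>

definition coxeter_matrix :: "'a set \<Rightarrow> ('a \<Rightarrow> 'a \<Rightarrow> enat) \<Rightarrow> bool" where
  "coxeter_matrix S m \<longleftrightarrow>
     (\<forall>s\<in>S. m s s = 1) \<and>
     (\<forall>s\<in>S. \<forall>t\<in>S. m s t = m t s \<and> (s \<noteq> t \<longrightarrow> m s t \<ge> 2))"

definition word_prod :: "('a, 'b) monoid_scheme \<Rightarrow> 'a list \<Rightarrow> 'a" where
  "word_prod W xs = foldr (\<otimes>\<^bsub>W\<^esub>) xs \<one>\<^bsub>W\<^esub>"

text \<open>Insertion of a relator \<open>(s t)^k\<close>, \<open>k = m s t < \<infinity>\<close>, into a word over \<open>S\<close>.  As \<open>m s s = 1\<close>,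
  the words \<open>s s\<close> are among the relators, so formal inverses of letters are not needed and the
  group presented by \<open>(S, m)\<close> is the quotient of the free monoid on \<open>S\<close> by the equivalence relation
  that these insertions generate.\<close>

inductive insert_relator :: "'a set \<Rightarrow> ('a \<Rightarrow> 'a \<Rightarrow> enat) \<Rightarrow> 'a list \<Rightarrow> 'a list \<Rightarrow> bool"
  for S m where
  "\<lbrakk>xs \<in> lists S; ys \<in> lists S; s \<in> S; t \<in> S; m s t = enat k\<rbrakk> \<Longrightarrow>
     insert_relator S m (xs @ ys) (xs @ concat (replicate k [s, t]) @ ys)"

text \<open>\<open>W\<close> is generated by \<open>S\<close>, and two words over \<open>S\<close> have the same value in \<open>W\<close> if and only
  if they represent the same element of the group presented by some Coxeter matrix on \<open>S\<close>.\<close>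

definition coxeter_system :: "('a, 'b) monoid_scheme \<Rightarrow> 'a set \<Rightarrow> bool" where
  "coxeter_system W S \<longleftrightarrow>
     group W \<and> S \<subseteq> carrier W \<and> generate W S = carrier W \<and>
     (\<exists>m. coxeter_matrix S m \<and>
        (\<forall>xs\<in>lists S. \<forall>ys\<in>lists S.
           word_prod W xs = word_prod W ys \<longleftrightarrow> equivclp (insert_relator S m) xs ys))"

definition cox_length :: "('a, 'b) monoid_scheme \<Rightarrow> 'a set \<Rightarrow> 'a \<Rightarrow> nat" where
  "cox_length W S w = (LEAST n. \<exists>xs\<in>lists S. length xs = n \<and> word_prod W xs = w)"

definition right_descents :: "('a, 'b) monoid_scheme \<Rightarrow> 'a set \<Rightarrow> 'a \<Rightarrow> 'a set" where
  "right_descents W S w = {s \<in> S. cox_length W S (w \<otimes>\<^bsub>W\<^esub> s) < cox_length W S w}"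

definition reflections :: "('a, 'b) monoid_scheme \<Rightarrow> 'a set \<Rightarrow> 'a set" where
  "reflections W S = {x \<otimes>\<^bsub>W\<^esub> s \<otimes>\<^bsub>W\<^esub> inv\<^bsub>W\<^esub> x | x s. x \<in> carrier W \<and> s \<in> S}"

definition bruhat_step :: "('a, 'b) monoid_scheme \<Rightarrow> 'a set \<Rightarrow> 'a \<Rightarrow> 'a \<Rightarrow> bool" where
  "bruhat_step W S u v \<longleftrightarrow> u \<in> carrier W \<and>
     (\<exists>t\<in>reflections W S. v = u \<otimes>\<^bsub>W\<^esub> t) \<and> cox_length W S u < cox_length W S v"

definition bruhat_le :: "('a, 'b) monoid_scheme \<Rightarrow> 'a set \<Rightarrow> 'a \<Rightarrow> 'a \<Rightarrow> bool" where
  "bruhat_le W S = (bruhat_step W S)\<^sup>*\<^sup>*"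


section \<open>Twisted involutions\<close>

definition twisted_involutions :: "('a, 'b) monoid_scheme \<Rightarrow> ('a \<Rightarrow> 'a) \<Rightarrow> 'a set" where
  "twisted_involutions W \<theta> = {w \<in> carrier W. \<theta> w = inv\<^bsub>W\<^esub> w}"

definition Br_twisted :: "('a, 'b) monoid_scheme \<Rightarrow> 'a set \<Rightarrow> ('a \<Rightarrow> 'a) \<Rightarrow> 'a gorder" where
  "Br_twisted W S \<theta> =
     \<lparr>carrier = twisted_involutions W \<theta>, eq = (=), le = bruhat_le W S\<rparr>"

definition twisted_act :: "('a, 'b) monoid_scheme \<Rightarrow> ('a \<Rightarrow> 'a) \<Rightarrow> 'a \<Rightarrow> 'a \<Rightarrow> 'a" where
  "twisted_act W \<theta> v s =
     (if \<theta> s \<otimes>\<^bsub>W\<^esub> v \<otimes>\<^bsub>W\<^esub> s = v then v \<otimes>\<^bsub>W\<^esub> s else \<theta> s \<otimes>\<^bsub>W\<^esub> v \<otimes>\<^bsub>W\<^esub> s)"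

lemma bruhat_le_imp_length:
  assumes "bruhat_le W S u v"
  shows "u = v \<or> cox_length W S u < cox_length W S v"
  using assms unfolding bruhat_le_def
  by (induction rule: rtranclp_induct) (auto simp: bruhat_step_def)

lemma partial_order_Br_twisted: "partial_order (Br_twisted W S \<theta>)"
proof unfold_locales
  fix x y
  assume "x \<sqsubseteq>\<^bsub>Br_twisted W S \<theta>\<^esub> y" "y \<sqsubseteq>\<^bsub>Br_twisted W S \<theta>\<^esub> x"
  then show "x .=\<^bsub>Br_twisted W S \<theta>\<^esub> y"
    using bruhat_le_imp_length[of W S x y] bruhat_le_imp_length[of W S y x]
    by (auto simp: Br_twisted_def)
qed (auto simp: Br_twisted_def bruhat_le_def)


section \<open>Special matchings\<close>

definition covers :: "('a, 'b) gorder_scheme \<Rightarrow> 'a \<Rightarrow> 'a \<Rightarrow> bool" where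
  "covers Q y x \<longleftrightarrow> x \<in> carrier Q \<and> y \<in> carrier Q \<and> x \<sqsubset>\<^bsub>Q\<^esub> y \<and>
     \<not> (\<exists>z\<in>carrier Q. x \<sqsubset>\<^bsub>Q\<^esub> z \<and> z \<sqsubset>\<^bsub>Q\<^esub> y)"

definition special_matching :: "('a, 'b) gorder_scheme \<Rightarrow> ('a \<Rightarrow> 'a) \<Rightarrow> bool" where
  "special_matching Q M \<longleftrightarrow>
     M \<in> carrier Q \<rightarrow> carrier Q \<and>
     (\<forall>x\<in>carrier Q. M (M x) = x) \<and>
     (\<forall>x\<in>carrier Q. covers Q x (M x) \<or> covers Q (M x) x) \<and>
     (\<forall>x\<in>carrier Q. \<forall>y\<in>carrier Q. M x \<noteq> y \<and> covers Q y x \<longrightarrow> M x \<sqsubset>\<^bsub>Q\<^esub> M y)"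

end

(* The parity of the number of times a reflection t occurs among the inversions of a word is
   unchanged by inserting relators, so it depends only on the element w, and it is odd iff
   l(tw) < l(w).  Hence a Bruhat edge u -> v with v ~= su is carried by left multiplication with s
   to a Bruhat edge su -> sv, and the lifting property follows by induction along chains.  Applying
   it on the right with s and on the left with theta(s) gives the lifting property for the action
   of s on twisted involutions, from which all the special matching conditions are read off. *)

theory Submission
  imports Defs
begin

text \<open>The matrix under the existential quantifier of \<open>coxeter_system\<close> becomes a
  parameter, so that one presentation is fixed throughout.\<close>

locale coxeter_group = group W for W :: "('a, 'b) monoid_scheme" (structure) +
  fixes S :: "'a set" and m :: "'a \<Rightarrow> 'a \<Rightarrow> enat"
  assumes S_sub: "S \<subseteq> carrier W"
    and generate_S: "generate W S = carrier W"
    and cox_matrix: "coxeter_matrix S m"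
    and presentation: "\<lbrakk>xs \<in> lists S; ys \<in> lists S\<rbrakk> \<Longrightarrow>
           word_prod W xs = word_prod W ys \<longleftrightarrow> equivclp (insert_relator S m) xs ys"
begin

section \<open>Words in the generators and the length function\<close>

abbreviation len :: "'a \<Rightarrow> nat" where "len \<equiv> cox_length W S"

abbreviation ble :: "'a \<Rightarrow> 'a \<Rightarrow> bool" where "ble \<equiv> bruhat_le W S"

lemma S_carrier [simp, intro]: "s \<in> S \<Longrightarrow> s \<in> carrier W"
  using S_sub by blast

lemma word_prod_Nil [simp]: "word_prod W [] = \<one>"
  by (simp add: word_prod_def)

lemma word_prod_Cons [simp]: "word_prod W (x # xs) = x \<otimes> word_prod W xs"
  by (simp add: word_prod_def)

lemma word_prod_closed [simp, intro]: "xs \<in> lists S \<Longrightarrow> word_prod W xs \<in> carrier W"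
  by (induction xs) auto

lemma word_prod_append:
  "xs \<in> lists S \<Longrightarrow> ys \<in> lists S \<Longrightarrow> word_prod W (xs @ ys) = word_prod W xs \<otimes> word_prod W ys"
  by (induction xs) (auto simp: m_assoc)

lemma relator_in_lists: "s \<in> S \<Longrightarrow> t \<in> S \<Longrightarrow> concat (replicate k [s, t]) \<in> lists S"
  by (induction k) auto

lemma word_prod_relator:
  "s \<in> S \<Longrightarrow> t \<in> S \<Longrightarrow> word_prod W (concat (replicate k [s, t])) = (s \<otimes> t) [^] k"
proof (induction k)
  case (Suc k)
  then show ?case using nat_pow_Suc2[of "s \<otimes> t" k] by (simp add: m_assoc del: nat_pow_Suc)
qed simp

text \<open>Inserting the relator into the empty word makes it equivalent to \<open>[]\<close>;
  \<open>presentation\<close> turns this into an equation in \<open>W\<close>.\<close>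

lemma relator_pow_one:
  assumes "s \<in> S" "t \<in> S" "m s t = enat k"
  shows "(s \<otimes> t) [^] k = \<one>"
proof -
  have "insert_relator S m ([] @ []) ([] @ concat (replicate k [s, t]) @ [])"
    by (rule insert_relator.intros) (use assms in auto)
  then have "equivclp (insert_relator S m) [] (concat (replicate k [s, t]))"
    by (auto intro: r_into_equivclp)
  then show ?thesis
    using presentation[of "[]" "concat (replicate k [s, t])"] relator_in_lists[of s t k]
      word_prod_relator[of s t k] assms by simp
qed

lemma S_square [simp]: "s \<in> S \<Longrightarrow> s \<otimes> s = \<one>"
  using relator_pow_one[of s s 1] cox_matrix
  by (simp add: coxeter_matrix_def one_enat_def)

lemma S_inv [simp]: "s \<in> S \<Longrightarrow> inv s = s"
  using inv_equality[of s s] by auto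

lemma S_cancel [simp]: "s \<in> S \<Longrightarrow> x \<in> carrier W \<Longrightarrow> s \<otimes> (s \<otimes> x) = x"
  by (simp flip: m_assoc)

lemma S_cancel_right [simp]: "s \<in> S \<Longrightarrow> x \<in> carrier W \<Longrightarrow> x \<otimes> s \<otimes> s = x"
  by (simp add: m_assoc)

lemma inv_cancel [simp]:
  "p \<in> carrier W \<Longrightarrow> x \<in> carrier W \<Longrightarrow> p \<otimes> (inv p \<otimes> x) = x"
  "p \<in> carrier W \<Longrightarrow> x \<in> carrier W \<Longrightarrow> inv p \<otimes> (p \<otimes> x) = x"
  by (simp_all flip: m_assoc)

lemma inv_word_prod: "xs \<in> lists S \<Longrightarrow> inv (word_prod W xs) = word_prod W (rev xs)"
proof (induction xs)
  case (Cons x xs)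
  then have "rev xs \<in> lists S" by auto
  then show ?case using Cons word_prod_append[of "rev xs" "[x]"] by (auto simp: inv_mult_group)
qed simp

text \<open>Generators are their own inverses, so the inverse case of \<open>generate\<close> needs
  no new letters.\<close>

lemma ex_word:
  assumes "w \<in> carrier W"
  obtains xs where "xs \<in> lists S" "word_prod W xs = w"
proof -
  have "w \<in> generate W S" using assms generate_S by simp
  then have "\<exists>xs\<in>lists S. word_prod W xs = w"
  proof (induction rule: generate.induct)
    case one
    show ?case by (intro bexI[of _ "[]"]) auto
  next
    case (incl h)
    then show ?case by (intro bexI[of _ "[h]"]) auto
  next
    case (inv h)
    then show ?case by (intro bexI[of _ "[h]"]) auto
  next
    case (eng h1 h2)
    then obtain xs ys where "xs \<in> lists S" "word_prod W xs = h1" "ys \<in> lists S" "word_prod W ys = h2"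
      by blast
    then show ?case by (intro bexI[of _ "xs @ ys"]) (auto simp: word_prod_append)
  qed
  then show ?thesis using that by blast
qed

lemma len_le: "xs \<in> lists S \<Longrightarrow> len (word_prod W xs) \<le> length xs"
  unfolding cox_length_def by (rule Least_le) blast

lemma reduced_word:
  assumes "w \<in> carrier W"
  obtains xs where "xs \<in> lists S" "word_prod W xs = w" "length xs = len w"
proof -
  have "\<exists>n. \<exists>xs\<in>lists S. length xs = n \<and> word_prod W xs = w"
    using ex_word[OF assms] by metis
  from LeastI_ex[OF this] show ?thesis
    using that unfolding cox_length_def by blast
qed

lemma len_one [simp]: "len \<one> = 0"
  using len_le[of "[]"] by simp

lemma len_inv_le: "w \<in> carrier W \<Longrightarrow> len (inv w) \<le> len w"
  by (metis reduced_word inv_word_prod len_le length_rev in_listsD in_listsI set_rev)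

lemma len_inv [simp]: "w \<in> carrier W \<Longrightarrow> len (inv w) = len w"
  using len_inv_le[of w] len_inv_le[of "inv w"] by simp

lemma len_S_mult: "s \<in> S \<Longrightarrow> w \<in> carrier W \<Longrightarrow> len (s \<otimes> w) \<le> Suc (len w)"
  by (metis reduced_word len_le word_prod_Cons length_Cons lists.Cons)

lemma len_mult_S:
  assumes "s \<in> S" "w \<in> carrier W"
  shows "len (w \<otimes> s) \<le> Suc (len w)"
  using len_S_mult[of s "inv w"] len_inv[of "w \<otimes> s"] assms by (simp add: inv_mult_group)

section \<open>Parity of inversions\<close>

text \<open>For a word \<open>s1 ... sk\<close>, this is the parity of the number of indices \<open>i\<close> with
  \<open>t = s1 ... s(i-1) si s(i-1) ... s1\<close>.\<close>

primrec inv_parity :: "'a list \<Rightarrow> 'a \<Rightarrow> bool" where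
  "inv_parity [] t = False"
| "inv_parity (x # xs) t = ((t = x) \<noteq> inv_parity xs (x \<otimes> t \<otimes> x))"

text \<open>Reflections read off \<open>ys\<close> appear in \<open>xs @ ys\<close> conjugated by
  the value of \<open>xs\<close>; on the argument \<open>t\<close> this becomes the inverse
  conjugation.\<close>

lemma inv_parity_append:
  "xs \<in> lists S \<Longrightarrow> t \<in> carrier W \<Longrightarrow>
     inv_parity (xs @ ys) t =
       (inv_parity xs t \<noteq> inv_parity ys (inv (word_prod W xs) \<otimes> t \<otimes> word_prod W xs))"
  by (induction xs arbitrary: t) (auto simp: inv_mult_group m_assoc)

text \<open>The dihedral relation: \<open>s\<close> inverts the rotation \<open>s t\<close>. It
  serves to collapse conjugates of \<open>s\<close> by powers of \<open>s t\<close>.\<close>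

lemma relator_conj:
  assumes "s \<in> S" "t \<in> S"
  shows "s \<otimes> inv ((s \<otimes> t) [^] (j::nat)) = (s \<otimes> t) [^] j \<otimes> s"
proof (induction j)
  case (Suc j)
  have "s \<otimes> inv ((s \<otimes> t) [^] Suc j) = s \<otimes> (t \<otimes> (s \<otimes> inv ((s \<otimes> t) [^] j)))"
    using assms by (simp add: inv_mult_group m_assoc)
  also have "\<dots> = s \<otimes> t \<otimes> (s \<otimes> t) [^] j \<otimes> s"
    using assms Suc by (simp add: m_assoc)
  also have "\<dots> = (s \<otimes> t) [^] Suc j \<otimes> s"
    using assms nat_pow_Suc2[of "s \<otimes> t" j] by simp
  finally show ?case .
qed (use assms in auto)

lemma conj_eq_iff:
  assumes "p \<in> carrier W" "u \<in> carrier W" "x \<in> carrier W"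
  shows "inv p \<otimes> u \<otimes> p = x \<longleftrightarrow> u = p \<otimes> x \<otimes> inv p"
proof
  assume "inv p \<otimes> u \<otimes> p = x"
  then have "p \<otimes> (inv p \<otimes> u \<otimes> p) \<otimes> inv p = p \<otimes> x \<otimes> inv p" by simp
  then show "u = p \<otimes> x \<otimes> inv p" using assms by (simp add: m_assoc)
next
  assume "u = p \<otimes> x \<otimes> inv p"
  then show "inv p \<otimes> u \<otimes> p = x" using assms by (simp add: m_assoc)
qed

text \<open>The reflections read off the word \<open>(s t)^j\<close> are \<open>(s t)^i s\<close> for \<open>i < 2 j\<close>.\<close>

lemma inv_parity_relator:
  assumes "s \<in> S" "t \<in> S" "u \<in> carrier W"
  shows "inv_parity (concat (replicate j [s, t])) u =
           odd (\<Sum>i<2 * j. of_bool (u = (s \<otimes> t) [^] i \<otimes> s) :: nat)"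
proof (induction j)
  case (Suc j)
  let ?c = "s \<otimes> t" and ?r = "concat (replicate j [s, t])"
  let ?p = "?c [^] j"
  have p: "?p \<in> carrier W" using assms by simp
  \<comment> \<open>The new pair is split off at the right end, so that it contributes exactly the
    indices \<open>2 * j\<close> and \<open>2 * j + 1\<close>.\<close>
  have "concat (replicate (Suc j) [s, t]) = ?r @ [s, t]"
    by (induction j) auto
  then have "inv_parity (concat (replicate (Suc j) [s, t])) u =
      (inv_parity ?r u \<noteq> inv_parity [s, t] (inv ?p \<otimes> u \<otimes> ?p))"
    using inv_parity_append[of ?r u "[s, t]"] assms relator_in_lists[of s t j]
    by (simp add: word_prod_relator)
  also have "inv_parity [s, t] (inv ?p \<otimes> u \<otimes> ?p) =
      ((inv ?p \<otimes> u \<otimes> ?p = s) \<noteq> (inv ?p \<otimes> u \<otimes> ?p = s \<otimes> t \<otimes> s))"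
  proof -
    have "s \<otimes> x \<otimes> s = t \<longleftrightarrow> x = s \<otimes> t \<otimes> s" if "x \<in> carrier W" for x
      using conj_eq_iff[of s x t] that assms by simp
    from this[of "inv ?p \<otimes> u \<otimes> ?p"] show ?thesis using assms p by simp
  qed
  also have "(inv ?p \<otimes> u \<otimes> ?p = s) = (u = ?c [^] (2 * j) \<otimes> s)"
    using conj_eq_iff[of ?p u s] assms p relator_conj[of s t j]
    by (simp add: m_assoc nat_pow_mult mult_2 flip: nat_pow_mult)
  also have "(inv ?p \<otimes> u \<otimes> ?p = s \<otimes> t \<otimes> s) = (u = ?c [^] Suc (2 * j) \<otimes> s)"
  proof -
    have "?p \<otimes> (?c \<otimes> s) \<otimes> inv ?p = ?p \<otimes> ?c \<otimes> (s \<otimes> inv ?p)"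
      using assms p by (simp add: m_assoc)
    also have "\<dots> = ?c [^] Suc j \<otimes> ?c [^] j \<otimes> s"
      using assms p relator_conj[of s t j] by (simp add: m_assoc)
    also have "?c [^] Suc j \<otimes> ?c [^] j = ?c [^] Suc (2 * j)"
      using assms nat_pow_mult[of "?c" "Suc j" j] by (simp add: mult_2 del: nat_pow_Suc)
    finally show ?thesis using conj_eq_iff[of ?p u "?c \<otimes> s"] assms p by simp
  qed
  finally show ?case using Suc.IH by (auto simp del: nat_pow_Suc)
qed simp

text \<open>Since \<open>(s t)^k\<close> is trivial, the list of reflections has period
  \<open>k\<close>; over \<open>2 * k\<close> indices each one is counted an even number of
  times.\<close>

lemma inv_parity_relator_trivial:
  assumes "s \<in> S" "t \<in> S" "u \<in> carrier W" "(s \<otimes> t) [^] k = \<one>"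
  shows "\<not> inv_parity (concat (replicate k [s, t])) u"
proof -
  define f where "f i = (of_bool (u = (s \<otimes> t) [^] i \<otimes> s) :: nat)" for i :: nat
  have "f (i + k) = f i" for i
    using assms by (simp add: f_def flip: nat_pow_mult)
  moreover have "(\<Sum>i<2 * k. f i) = (\<Sum>i<k. f i) + (\<Sum>i<k. f (i + k))"
    using sum.atLeastLessThan_concat[of 0 k "2 * k" f] sum.shift_bounds_nat_ivl[of f 0 k k]
    by (simp add: mult_2 lessThan_atLeast0)
  ultimately show ?thesis
    using inv_parity_relator[OF assms(1-3), of k] by (simp add: f_def)
qed

text \<open>The relator contributes even parity, and its value is \<open>\<one>\<close>, so the
  letters after it are conjugated as before.\<close>

lemma inv_parity_insert_relator:
  assumes "insert_relator S m a b" "u \<in> carrier W"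
  shows "inv_parity a u = inv_parity b u"
  using assms(1)
proof cases
  case (1 xs ys s t k)
  let ?r = "concat (replicate k [s, t])"
  have c: "(s \<otimes> t) [^] k = \<one>" using relator_pow_one 1 by blast
  have r: "?r \<in> lists S" using relator_in_lists 1 by blast
  let ?v = "inv (word_prod W xs) \<otimes> u \<otimes> word_prod W xs"
  have v: "?v \<in> carrier W" using 1 assms(2) by auto
  have "inv_parity (?r @ ys) ?v = inv_parity ys ?v"
    using inv_parity_append[OF r v] inv_parity_relator_trivial[OF _ _ v c] 1 v c
    by (simp add: word_prod_relator)
  then show ?thesis
    using 1 assms(2) by (simp add: inv_parity_append)
qed

lemma inv_parity_cong:
  assumes "xs \<in> lists S" "ys \<in> lists S" "word_prod W xs = word_prod W ys" "u \<in> carrier W"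
  shows "inv_parity xs u = inv_parity ys u"
proof -
  have "equivclp (insert_relator S m) xs ys" using presentation assms by blast
  then show ?thesis
    by (induction rule: equivclp_induct) (use inv_parity_insert_relator assms(4) in blast)+
qed

text \<open>By \<open>inv_parity_cong\<close> any word for \<open>w\<close> gives the same answer,
  so the existential could equally be a universal quantifier when \<open>t\<close> and
  \<open>w\<close> lie in \<open>W\<close>.\<close>

definition is_inversion :: "'a \<Rightarrow> 'a \<Rightarrow> bool" where
  "is_inversion w t \<longleftrightarrow> (\<exists>xs\<in>lists S. word_prod W xs = w \<and> inv_parity xs t)"

lemma is_inversion_word_prod:
  "xs \<in> lists S \<Longrightarrow> t \<in> carrier W \<Longrightarrow> is_inversion (word_prod W xs) t = inv_parity xs t"
  using inv_parity_cong unfolding is_inversion_def by blast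

text \<open>The cocycle identity for inversion sets, with symmetric difference as sum. All later
  uses of parity go through it instead of through words.\<close>

lemma is_inversion_mult:
  assumes "u \<in> carrier W" "v \<in> carrier W" "t \<in> carrier W"
  shows "is_inversion (u \<otimes> v) t = (is_inversion u t \<noteq> is_inversion v (inv u \<otimes> t \<otimes> u))"
proof -
  obtain xs where xs: "xs \<in> lists S" "word_prod W xs = u" using ex_word assms(1) .
  obtain ys where ys: "ys \<in> lists S" "word_prod W ys = v" using ex_word assms(2) .
  show ?thesis
    using is_inversion_word_prod[of "xs @ ys" t] is_inversion_word_prod[of xs t]
      is_inversion_word_prod[of ys "inv u \<otimes> t \<otimes> u"] xs ys assms
    by (simp add: word_prod_append inv_parity_append)
qed

lemma is_inversion_S: "s \<in> S \<Longrightarrow> t \<in> carrier W \<Longrightarrow> is_inversion s t \<longleftrightarrow> t = s"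
  using is_inversion_word_prod[of "[s]" t] by simp

lemma is_inversion_one: "t \<in> carrier W \<Longrightarrow> \<not> is_inversion \<one> t"
  using is_inversion_word_prod[of "[]" t] by simp

section \<open>Reflections and the strong exchange property\<close>

lemma reflection_carrier [simp, intro]: "t \<in> reflections W S \<Longrightarrow> t \<in> carrier W"
  by (auto simp: reflections_def)

lemma reflectionE:
  assumes "t \<in> reflections W S"
  obtains x s where "t = x \<otimes> s \<otimes> inv x" "x \<in> carrier W" "s \<in> S"
  using assms unfolding reflections_def by blast

lemma S_reflection: "s \<in> S \<Longrightarrow> s \<in> reflections W S"
  unfolding reflections_def by (auto intro!: exI[of _ "\<one>"] exI[of _ s])

lemma reflection_conj:
  assumes "t \<in> reflections W S" "x \<in> carrier W"
  shows "x \<otimes> t \<otimes> inv x \<in> reflections W S"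
proof -
  obtain y s where "t = y \<otimes> s \<otimes> inv y" "y \<in> carrier W" "s \<in> S"
    using assms(1) by (rule reflectionE)
  then have "x \<otimes> t \<otimes> inv x = (x \<otimes> y) \<otimes> s \<otimes> inv (x \<otimes> y)"
    using assms by (simp add: m_assoc inv_mult_group)
  then show ?thesis
    unfolding reflections_def using \<open>y \<in> carrier W\<close> \<open>s \<in> S\<close> assms(2) by blast
qed

lemma reflection_square [simp]:
  assumes "t \<in> reflections W S"
  shows "t \<otimes> t = \<one>"
proof -
  obtain y s where y: "t = y \<otimes> s \<otimes> inv y" "y \<in> carrier W" "s \<in> S"
    using assms(1) by (rule reflectionE)
  then have "t \<otimes> t = y \<otimes> (s \<otimes> (inv y \<otimes> y) \<otimes> s) \<otimes> inv y"
    by (simp only: m_assoc m_closed S_carrier inv_closed)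
  then show ?thesis using y by simp
qed

lemma reflection_inv [simp]: "t \<in> reflections W S \<Longrightarrow> inv t = t"
  using inv_equality[of t t] by auto

lemma reflection_cancel [simp]:
  "t \<in> reflections W S \<Longrightarrow> x \<in> carrier W \<Longrightarrow> t \<otimes> (t \<otimes> x) = x"
  by (simp flip: m_assoc)

text \<open>For \<open>t = x s x^-1\<close> the cocycle identity gives three contributions: those of
  \<open>x\<close> and \<open>x^-1\<close> cancel, and that of \<open>s\<close> is odd.\<close>

lemma is_inversion_reflection:
  assumes "t \<in> reflections W S"
  shows "is_inversion t t"
proof -
  obtain x s where t: "t = x \<otimes> s \<otimes> inv x" "x \<in> carrier W" "s \<in> S"
    using assms(1) by (rule reflectionE)
  have c: "inv x \<otimes> t \<otimes> x = s"
    using t conj_eq_iff[of x t s] by auto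
  have "is_inversion t t = (is_inversion (x \<otimes> s) t \<noteq> is_inversion (inv x) (inv (x \<otimes> s) \<otimes> t \<otimes> (x \<otimes> s)))"
    using is_inversion_mult[of "x \<otimes> s" "inv x" t] t by simp
  also have "inv (x \<otimes> s) \<otimes> t \<otimes> (x \<otimes> s) = s \<otimes> (inv x \<otimes> t \<otimes> x) \<otimes> s"
    using t(2,3) assms by (simp add: inv_mult_group m_assoc)
  also have "\<dots> = s" using c t by simp
  also have "is_inversion (x \<otimes> s) t = (is_inversion x t \<noteq> True)"
    using is_inversion_mult[of x s t] c t(2,3) assms is_inversion_S[of s s] by simp
  \<comment> \<open>Applied to \<open>x x^-1 = \<one>\<close>, the cocycle identity shows that
    \<open>is_inversion x t\<close> and \<open>is_inversion (inv x) s\<close> agree.\<close>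
  finally show ?thesis
    using is_inversion_mult[of x "inv x" t] c t(2) assms is_inversion_one[of t] by auto
qed

text \<open>Odd parity means that \<open>t\<close> occurs at some letter; deleting that letter
  multiplies the value by \<open>t\<close> on the left.\<close>

lemma inv_parity_imp_shorter:
  "xs \<in> lists S \<Longrightarrow> t \<in> carrier W \<Longrightarrow> inv_parity xs t \<Longrightarrow>
     \<exists>ys\<in>lists S. length ys < length xs \<and> word_prod W ys = t \<otimes> word_prod W xs"
proof (induction xs arbitrary: t)
  case (Cons x xs)
  show ?case
  proof (cases "t = x")
    case True
    then show ?thesis using Cons.prems by (intro bexI[of _ xs]) auto
  next
    case False
    then have "inv_parity xs (x \<otimes> t \<otimes> x)" "xs \<in> lists S" "x \<otimes> t \<otimes> x \<in> carrier W"
      using Cons.prems by auto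
    then obtain ys where "ys \<in> lists S" "length ys < length xs"
      "word_prod W ys = x \<otimes> t \<otimes> x \<otimes> word_prod W xs"
      using Cons.IH by blast
    then show ?thesis using Cons.prems by (intro bexI[of _ "x # ys"]) (auto simp: m_assoc)
  qed
qed simp

lemma is_inversion_imp_len:
  assumes "w \<in> carrier W" "t \<in> carrier W" "is_inversion w t"
  shows "len (t \<otimes> w) < len w"
proof -
  obtain xs where xs: "xs \<in> lists S" "word_prod W xs = w" "length xs = len w"
    using reduced_word assms(1) .
  then show ?thesis
    using inv_parity_imp_shorter[of xs t] is_inversion_word_prod[of xs t] len_le assms
    by (metis order_le_less_trans)
qed

text \<open>As \<open>t\<close> is an inversion of itself, it is an inversion of exactly one of
  \<open>w\<close> and \<open>t w\<close>; the one-sided length bound then decides both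
  directions.\<close>

lemma is_inversion_iff_len:
  assumes "w \<in> carrier W" "t \<in> reflections W S"
  shows "is_inversion w t \<longleftrightarrow> len (t \<otimes> w) < len w"
proof
  assume l: "len (t \<otimes> w) < len w"
  show "is_inversion w t"
  proof (rule ccontr)
    assume "\<not> is_inversion w t"
    then have "is_inversion (t \<otimes> w) t"
      using is_inversion_mult[of t w t] is_inversion_reflection[OF assms(2)] assms by simp
    then have "len (t \<otimes> (t \<otimes> w)) < len (t \<otimes> w)"
      using is_inversion_imp_len assms by blast
    then show False using l assms by simp
  qed
qed (use is_inversion_imp_len assms in blast)

lemma len_reflection_neq:
  assumes "w \<in> carrier W" "t \<in> reflections W S"
  shows "len (t \<otimes> w) \<noteq> len w"
proof (cases "is_inversion w t")
  case False
  then have "is_inversion (t \<otimes> w) t"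
    using is_inversion_mult[of t w t] is_inversion_reflection[OF assms(2)] assms by simp
  then show ?thesis using is_inversion_iff_len[of "t \<otimes> w" t] assms by simp
qed (use is_inversion_iff_len assms in force)

section \<open>Lifting in the Bruhat order\<close>

text \<open>Reflections are closed under conjugation, so a reflection can be moved from one side of
  \<open>u\<close> to the other.\<close>

lemma bruhat_step_left:
  "bruhat_step W S u v \<longleftrightarrow>
     u \<in> carrier W \<and> (\<exists>t\<in>reflections W S. v = t \<otimes> u) \<and> len u < len v"
proof -
  have "(\<exists>t\<in>reflections W S. v = u \<otimes> t) \<longleftrightarrow> (\<exists>t\<in>reflections W S. v = t \<otimes> u)"
    if u: "u \<in> carrier W"
  proof
    assume "\<exists>t\<in>reflections W S. v = u \<otimes> t"
    then obtain t where "t \<in> reflections W S" "v = u \<otimes> t" by blast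
    then show "\<exists>t\<in>reflections W S. v = t \<otimes> u"
      using reflection_conj[of t u] u by (intro bexI[of _ "u \<otimes> t \<otimes> inv u"]) (auto simp: m_assoc)
  next
    assume "\<exists>t\<in>reflections W S. v = t \<otimes> u"
    then obtain t where "t \<in> reflections W S" "v = t \<otimes> u" by blast
    then show "\<exists>t\<in>reflections W S. v = u \<otimes> t"
      using reflection_conj[of t "inv u"] u
      by (intro bexI[of _ "inv u \<otimes> t \<otimes> u"]) (auto simp: m_assoc)
  qed
  then show ?thesis unfolding bruhat_step_def by blast
qed

lemma bruhat_step_carrier:
  "bruhat_step W S u v \<Longrightarrow> u \<in> carrier W" "bruhat_step W S u v \<Longrightarrow> v \<in> carrier W"
  by (auto simp: bruhat_step_def)

lemma ble_refl [simp, intro]: "ble u u"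
  by (simp add: bruhat_le_def)

lemma ble_trans: "ble u v \<Longrightarrow> ble v x \<Longrightarrow> ble u x"
  unfolding bruhat_le_def by (rule rtranclp_trans)

lemma ble_antisym: "ble u v \<Longrightarrow> ble v u \<Longrightarrow> u = v"
  using bruhat_le_imp_length[of W S u v] bruhat_le_imp_length[of W S v u] by auto

text \<open>The edge from \<open>s u\<close> to \<open>s v\<close> has reflection
  \<open>s t s\<close>. As this differs from \<open>s\<close>, the cocycle identity makes it an
  inversion of \<open>s v\<close> because \<open>t\<close> is one of \<open>v\<close>.\<close>

lemma bruhat_step_S_mult:
  assumes "bruhat_step W S u v" "s \<in> S" "v \<noteq> s \<otimes> u"
  shows "bruhat_step W S (s \<otimes> u) (s \<otimes> v)"
proof -
  obtain t where t: "t \<in> reflections W S" "v = t \<otimes> u" "u \<in> carrier W" "len u < len v"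
    using assms(1) by (auto simp: bruhat_step_left)
  have v: "v \<in> carrier W" using t by auto
  have ts: "t \<noteq> s" using t assms by auto
  have r: "s \<otimes> t \<otimes> s \<in> reflections W S"
    using reflection_conj[of t s] t assms by simp
  have e: "s \<otimes> t \<otimes> s \<otimes> (s \<otimes> v) = s \<otimes> u" "s \<otimes> t \<otimes> s \<otimes> (s \<otimes> u) = s \<otimes> v"
    using t assms(2) by (auto simp: m_assoc)
  have "is_inversion v t"
    using is_inversion_iff_len[of v t] t v by simp
  moreover have "s \<otimes> t \<otimes> s \<noteq> s"
    using conj_eq_iff[of s t s] ts t assms(2) by simp
  moreover have "s \<otimes> (s \<otimes> t \<otimes> s) \<otimes> s = t"
    using t assms(2) by (simp add: m_assoc)
  ultimately have "is_inversion (s \<otimes> v) (s \<otimes> t \<otimes> s)"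
    using is_inversion_mult[of s v "s \<otimes> t \<otimes> s"] is_inversion_S[of s "s \<otimes> t \<otimes> s"] t v assms(2)
    by simp
  then have "len (s \<otimes> u) < len (s \<otimes> v)"
    using is_inversion_iff_len[OF _ r, of "s \<otimes> v"] e v assms(2) by simp
  then show ?thesis
    unfolding bruhat_step_left using t(3) assms(2) r e(2)[symmetric] by blast
qed

lemma S_mult_step:
  assumes "s \<in> S" "v \<in> carrier W" "len (s \<otimes> v) < len v"
  shows "bruhat_step W S (s \<otimes> v) v"
  unfolding bruhat_step_left using assms S_reflection[of s] by (auto intro!: bexI[of _ s])

lemma S_mult_step':
  assumes "s \<in> S" "v \<in> carrier W" "\<not> len (s \<otimes> v) < len v"
  shows "bruhat_step W S v (s \<otimes> v)"
  unfolding bruhat_step_left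
  using assms S_reflection[of s] len_reflection_neq[of v s] by (auto intro!: bexI[of _ s])

text \<open>Each edge of the chain is carried along by \<open>s\<close>, or else its upper end is
  already \<open>s u\<close>. The descent of \<open>v\<close> is used only at the top of the
  chain.\<close>

lemma ble_S_mult:
  assumes "ble u v" "v \<in> carrier W" "s \<in> S" "len (s \<otimes> v) < len v"
  shows "ble (s \<otimes> u) v"
  using assms(1) unfolding bruhat_le_def
proof (induction rule: converse_rtranclp_induct)
  case base
  show ?case using S_mult_step assms by auto
next
  case (step u u')
  then show ?case
    using bruhat_step_S_mult[of u u' s] assms(3) by (cases "u' = s \<otimes> u") auto
qed

text \<open>The dual argument, growing the chain upwards; the ascent of \<open>u\<close> is used
  only at its bottom.\<close>

lemma ble_S_mult_right:
  assumes "ble u v" "u \<in> carrier W" "s \<in> S" "\<not> len (s \<otimes> u) < len u"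
  shows "ble u (s \<otimes> v)"
  using assms(1) unfolding bruhat_le_def
proof (induction rule: rtranclp_induct)
  case base
  show ?case using S_mult_step' assms by auto
next
  case (step v' v)
  then show ?case
    using bruhat_step_S_mult[of v' v s] assms(3) bruhat_step_carrier[of v' v]
    by (cases "v = s \<otimes> v'") auto
qed

lemma bruhat_step_inv:
  assumes "bruhat_step W S u v" shows "bruhat_step W S (inv u) (inv v)"
proof -
  obtain t where t: "t \<in> reflections W S" "v = u \<otimes> t" "u \<in> carrier W" "len u < len v"
    using assms by (auto simp: bruhat_step_def)
  then have "inv v = t \<otimes> inv u" by (simp add: inv_mult_group)
  moreover have "len (inv u) < len (inv v)" using t by simp
  ultimately show ?thesis unfolding bruhat_step_left using t by blast
qed

lemma ble_inv: "ble u v \<Longrightarrow> ble (inv u) (inv v)"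
  unfolding bruhat_le_def
proof (induction rule: rtranclp_induct)
  case (step y z)
  show ?case
    by (rule rtranclp.rtrancl_into_rtrancl[OF step.IH bruhat_step_inv[OF step.hyps(2)]])
qed simp

lemma ble_inv_iff: "u \<in> carrier W \<Longrightarrow> v \<in> carrier W \<Longrightarrow> ble (inv u) (inv v) \<longleftrightarrow> ble u v"
  using ble_inv[of u v] ble_inv[of "inv u" "inv v"] by auto

lemma len_S_mult_inv: "s \<in> S \<Longrightarrow> u \<in> carrier W \<Longrightarrow> len (s \<otimes> inv u) = len (u \<otimes> s)"
  using len_inv[of "u \<otimes> s"] by (simp add: inv_mult_group)

text \<open>Inversion preserves length and Bruhat order and exchanges left and right
  multiplication.\<close>

lemma ble_mult_S:
  assumes "ble u v" "u \<in> carrier W" "v \<in> carrier W" "s \<in> S" "len (v \<otimes> s) < len v"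
  shows "ble (u \<otimes> s) v"
proof -
  have "ble (s \<otimes> inv u) (inv v)"
    using assms by (intro ble_S_mult ble_inv) (auto simp: len_S_mult_inv)
  then show ?thesis
    using ble_inv_iff[of "u \<otimes> s" v] assms by (simp add: inv_mult_group)
qed

lemma ble_mult_S_right:
  assumes "ble u v" "u \<in> carrier W" "v \<in> carrier W" "s \<in> S" "\<not> len (u \<otimes> s) < len u"
  shows "ble u (v \<otimes> s)"
proof -
  have "ble (inv u) (s \<otimes> inv v)"
    using assms by (intro ble_S_mult_right ble_inv) (auto simp: len_S_mult_inv)
  then show ?thesis
    using ble_inv_iff[of u "v \<otimes> s"] assms by (simp add: inv_mult_group)
qed

lemma mult_S_step:
  assumes "s \<in> S" "v \<in> carrier W" "len (v \<otimes> s) < len v"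
  shows "bruhat_step W S (v \<otimes> s) v"
  using bruhat_step_inv[OF S_mult_step[of s "inv v"]] assms
  by (simp add: len_S_mult_inv inv_mult_group)

lemma mult_S_step':
  assumes "s \<in> S" "v \<in> carrier W" "\<not> len (v \<otimes> s) < len v"
  shows "bruhat_step W S v (v \<otimes> s)"
  using bruhat_step_inv[OF S_mult_step'[of s "inv v"]] assms
  by (simp add: len_S_mult_inv inv_mult_group)

end

section \<open>Twisted involutions\<close>

locale twisted_coxeter_group = coxeter_group +
  fixes \<theta> :: "'a \<Rightarrow> 'a"
  assumes theta_iso: "\<theta> \<in> iso W W"
    and theta_theta: "x \<in> carrier W \<Longrightarrow> \<theta> (\<theta> x) = x"
    and theta_S_eq: "\<theta> ` S = S"
begin

abbreviation TI :: "'a set" where "TI \<equiv> twisted_involutions W \<theta>"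

abbreviation act :: "'a \<Rightarrow> 'a \<Rightarrow> 'a" where "act v s \<equiv> twisted_act W \<theta> v s"

section \<open>The automorphism and its compatibility with length\<close>

lemma theta_carrier [simp, intro]: "x \<in> carrier W \<Longrightarrow> \<theta> x \<in> carrier W"
  using theta_iso by (auto simp: iso_def hom_def)

lemma theta_mult [simp]:
  "x \<in> carrier W \<Longrightarrow> y \<in> carrier W \<Longrightarrow> \<theta> (x \<otimes> y) = \<theta> x \<otimes> \<theta> y"
  using theta_iso by (auto simp: iso_def hom_def)

lemma theta_one [simp]: "\<theta> \<one> = \<one>"
  using theta_iso hom_one[of \<theta> W W] is_group by (auto simp: iso_def)

lemma theta_S [simp, intro]: "s \<in> S \<Longrightarrow> \<theta> s \<in> S"
  using theta_S_eq by blast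

lemma theta_word_prod: "xs \<in> lists S \<Longrightarrow> \<theta> (word_prod W xs) = word_prod W (map \<theta> xs)"
  by (induction xs) auto

lemma len_theta_le:
  assumes "w \<in> carrier W"
  shows "len (\<theta> w) \<le> len w"
proof -
  obtain xs where xs: "xs \<in> lists S" "word_prod W xs = w" "length xs = len w"
    using reduced_word assms .
  then have "map \<theta> xs \<in> lists S" by auto
  from len_le[OF this] show ?thesis using theta_word_prod[of xs] xs by simp
qed

lemma len_theta [simp]: "w \<in> carrier W \<Longrightarrow> len (\<theta> w) = len w"
  using len_theta_le[of w] len_theta_le[of "\<theta> w"] by (simp add: theta_theta)

lemma mem_TI_iff: "v \<in> carrier W \<Longrightarrow> v \<in> TI \<longleftrightarrow> \<theta> v = inv v"
  by (simp add: twisted_involutions_def)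

lemma one_TI: "\<one> \<in> TI"
  by (simp add: twisted_involutions_def)

lemma TI_carrier [simp, intro]: "v \<in> TI \<Longrightarrow> v \<in> carrier W"
  and theta_TI: "v \<in> TI \<Longrightarrow> \<theta> v = inv v"
  by (auto simp: twisted_involutions_def)

text \<open>The inverse of \<open>\<theta> s v\<close> is \<open>\<theta> (v s)\<close>. Thus right
  descents \<open>s\<close> of a twisted involution match left descents
  \<open>\<theta> s\<close>.\<close>

lemma len_theta_S_mult:
  assumes "v \<in> TI" "s \<in> S"
  shows "len (\<theta> s \<otimes> v) = len (v \<otimes> s)"
proof -
  have "len (\<theta> s \<otimes> v) = len (inv v \<otimes> \<theta> s)"
    using len_inv[of "\<theta> s \<otimes> v"] assms by (simp add: inv_mult_group)
  also have "\<dots> = len (\<theta> (v \<otimes> s))" using assms by (simp add: theta_TI)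
  finally show ?thesis using len_theta[of "v \<otimes> s"] assms by (simp del: theta_mult)
qed

lemma commute_iff:
  assumes "v \<in> TI" "s \<in> S"
  shows "\<theta> s \<otimes> v \<otimes> s = v \<longleftrightarrow> v \<otimes> s = \<theta> s \<otimes> v"
  using assms by (metis S_cancel_right S_carrier TI_carrier m_closed theta_S)

text \<open>For \<open>v s\<close>, being a twisted involution says that \<open>\<theta> s v\<close>
  and \<open>v s\<close> have the same inverse.\<close>

lemma mult_S_TI_iff:
  assumes "v \<in> TI" "s \<in> S"
  shows "v \<otimes> s \<in> TI \<longleftrightarrow> \<theta> s \<otimes> v \<otimes> s = v"
proof -
  have "v \<otimes> s \<in> TI \<longleftrightarrow> inv v \<otimes> \<theta> s = s \<otimes> inv v"
    using assms theta_TI[of v] mem_TI_iff[of "v \<otimes> s"] by (simp add: inv_mult_group)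
  also have "\<dots> \<longleftrightarrow> inv (\<theta> s \<otimes> v) = inv (v \<otimes> s)"
    using assms by (simp add: inv_mult_group)
  also have "\<dots> \<longleftrightarrow> \<theta> s \<otimes> v = v \<otimes> s"
    using assms inj_on_eq_iff[OF inv_inj, of "\<theta> s \<otimes> v" "v \<otimes> s"] by simp
  finally show ?thesis using commute_iff[OF assms] by auto
qed

section \<open>The action of a generator on twisted involutions\<close>

lemma act_TI [simp, intro]:
  assumes "v \<in> TI" "s \<in> S"
  shows "act v s \<in> TI"
proof (cases "\<theta> s \<otimes> v \<otimes> s = v")
  case True
  then show ?thesis using mult_S_TI_iff[OF assms] by (simp add: twisted_act_def)
next
  case False
  then show ?thesis
    using assms theta_TI[of v] mem_TI_iff[of "\<theta> s \<otimes> v \<otimes> s"]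
    by (simp add: twisted_act_def theta_theta inv_mult_group m_assoc)
qed

lemma act_act:
  assumes "v \<in> TI" "s \<in> S"
  shows "act (act v s) s = v"
proof (cases "\<theta> s \<otimes> v \<otimes> s = v")
  case True
  then have "v \<otimes> s = \<theta> s \<otimes> v" using commute_iff[OF assms] by simp
  then show ?thesis using True assms by (simp add: twisted_act_def flip: m_assoc)
next
  case False
  \<comment> \<open>This puts the second application in the two-sided branch as well, since
    \<open>v\<close> differs from \<open>act v s\<close>, and also computes its value.\<close>
  have "\<theta> s \<otimes> (\<theta> s \<otimes> v \<otimes> s) \<otimes> s = v" using assms by (simp add: m_assoc)
  then show ?thesis using False by (auto simp: twisted_act_def)
qed

lemma act_inj: "u \<in> TI \<Longrightarrow> v \<in> TI \<Longrightarrow> s \<in> S \<Longrightarrow> act u s = act v s \<Longrightarrow> u = v"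
  by (metis act_act)

text \<open>Twisted analogues of the two halves of the lifting property: apply the ordinary one
  on the right with \<open>s\<close> and then, if needed, on the left with \<open>\<theta> s\<close>.\<close>

lemma act_ble:
  assumes "ble u v" "u \<in> TI" "v \<in> TI" "s \<in> S" "len (v \<otimes> s) < len v"
  shows "ble (act u s) v"
proof -
  have 1: "ble (u \<otimes> s) v" using ble_mult_S assms by blast
  have "ble (\<theta> s \<otimes> (u \<otimes> s)) v"
    by (rule ble_S_mult) (use 1 assms len_theta_S_mult[of v s] in auto)
  then show ?thesis using 1 assms by (simp add: twisted_act_def m_assoc)
qed

lemma ble_act:
  assumes "ble u v" "u \<in> TI" "v \<in> TI" "s \<in> S" "\<not> len (u \<otimes> s) < len u"
  shows "ble u (act v s)"
proof -
  have 1: "ble u (v \<otimes> s)" using ble_mult_S_right assms by blast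
  have "ble u (\<theta> s \<otimes> (v \<otimes> s))"
    by (rule ble_S_mult_right) (use 1 assms len_theta_S_mult[of u s] in auto)
  then show ?thesis using 1 assms by (simp add: twisted_act_def m_assoc)
qed

lemma act_ble_self:
  assumes "v \<in> TI" "s \<in> S" "len (v \<otimes> s) < len v"
  shows "ble (act v s) v"
  using act_ble[of v v s] assms by simp

lemma ble_act_self:
  assumes "v \<in> TI" "s \<in> S" "\<not> len (v \<otimes> s) < len v"
  shows "ble v (act v s)"
  using ble_act[of v v s] assms by simp

lemma act_neq:
  assumes "v \<in> TI" "s \<in> S"
  shows "act v s \<noteq> v"
proof -
  have "v \<otimes> s \<noteq> v"
    using mult_S_step[of s v] mult_S_step'[of s v] assms
    by (metis S_carrier TI_carrier bruhat_step_def less_irrefl)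
  then show ?thesis by (simp add: twisted_act_def)
qed

lemma act_descent:
  assumes "v \<in> TI" "s \<in> S" "len (v \<otimes> s) < len v"
  shows "\<not> len (act v s \<otimes> s) < len (act v s)"
proof (cases "\<theta> s \<otimes> v \<otimes> s = v")
  case True
  then show ?thesis using assms by (simp add: twisted_act_def)
next
  case False
  \<comment> \<open>The edge from \<open>v s\<close> to \<open>v\<close> is carried along by
    \<open>\<theta> s\<close>; its image ends at \<open>\<theta> s v\<close>, which is
    \<open>act v s\<close> times \<open>s\<close>.\<close>
  have "bruhat_step W S (\<theta> s \<otimes> (v \<otimes> s)) (\<theta> s \<otimes> v)"
    using False assms by (intro bruhat_step_S_mult mult_S_step) (auto simp: m_assoc)
  then show ?thesis using False assms
    by (auto simp: twisted_act_def bruhat_step_def m_assoc)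
qed

text \<open>Otherwise \<open>act v s\<close> would lie below its own image \<open>v\<close> as well
  as above it, against antisymmetry and \<open>act_neq\<close>.\<close>

lemma act_ascent:
  assumes "v \<in> TI" "s \<in> S" "\<not> len (v \<otimes> s) < len v"
  shows "len (act v s \<otimes> s) < len (act v s)"
proof (rule ccontr)
  assume "\<not> ?thesis"
  then have "ble (act v s) v"
    using ble_act_self[of "act v s" s] act_act assms by simp
  then show False
    using ble_act_self[of v s] ble_antisym act_neq assms by blast
qed

lemma len_act:
  assumes "v \<in> TI" "s \<in> S"
  shows "len v \<le> len (act v s) + 2"
proof -
  have "len v \<le> Suc (len (v \<otimes> s))"
    using len_mult_S[of s "v \<otimes> s"] assms by simp
  moreover have "len (v \<otimes> s) \<le> Suc (len (\<theta> s \<otimes> v \<otimes> s))"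
    using len_S_mult[of "\<theta> s" "\<theta> s \<otimes> v \<otimes> s"] assms by (simp add: m_assoc)
  ultimately show ?thesis by (simp add: twisted_act_def)
qed

text \<open>If \<open>z\<close> lies strictly between \<open>act v s\<close> and \<open>v\<close>, then lengths differ by one at each step and
  lifting forces \<open>act v s = z s\<close> or \<open>z = v s\<close>; but right multiplication by \<open>s\<close> preserves
  twisted involutions only in the commuting case.\<close>

lemma no_TI_between_act:
  assumes "v \<in> TI" "z \<in> TI" "s \<in> S" "len (v \<otimes> s) < len v"
    and "ble (act v s) z" "ble z v"
  shows "z = act v s \<or> z = v"
proof (rule ccontr)
  assume "\<not> ?thesis"
  then have l: "len (act v s) < len z" "len z < len v"
    using bruhat_le_imp_length[OF assms(5)] bruhat_le_imp_length[OF assms(6)] by auto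
  \<comment> \<open>By \<open>len_act\<close> the total gap is at most two, so each of the two
    strict inequalities is a gap of exactly one.\<close>
  then have lz: "len z = Suc (len (act v s))" "len v = Suc (len z)"
    using len_act[of v s] assms by auto
  have nc: "\<theta> s \<otimes> v \<otimes> s \<noteq> v"
  proof
    assume "\<theta> s \<otimes> v \<otimes> s = v"
    then show False using len_mult_S[of s "v \<otimes> s"] lz assms(1,3) by (simp add: twisted_act_def)
  qed
  let ?x = "act v s"
  have x: "?x \<in> TI" using assms by blast
  show False
  proof (cases "len (z \<otimes> s) < len z")
    case True
    have "ble ?x (z \<otimes> s)"
      using ble_mult_S_right[of ?x z s] act_descent[of v s] assms x by blast
    then have "?x = z \<otimes> s"
      using bruhat_le_imp_length[of W S ?x "z \<otimes> s"] True lz by auto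
    \<comment> \<open>As \<open>z s\<close> equals the twisted involution \<open>?x\<close>, the
      one-sided branch of the action applies to \<open>z\<close>.\<close>
    then have "?x = act z s" using mult_S_TI_iff[of z s] x assms by (simp add: twisted_act_def)
    then have "z = v" using act_inj[of z v s] assms(1-3) by metis
    then show False using l by simp
  next
    case False
    have "ble z (v \<otimes> s)" using ble_mult_S_right[of z v s] False assms by blast
    then have "z = v \<otimes> s"
      using bruhat_le_imp_length[of W S z "v \<otimes> s"] lz assms(4) by auto
    then show False using mult_S_TI_iff[of v s] nc assms by blast
  qed
qed

text \<open>If \<open>s\<close> descends \<open>x\<close>, lift from \<open>act x s\<close> below
  \<open>y\<close>. Otherwise \<open>s\<close> ascends \<open>y\<close> too, and the lift is from
  \<open>x\<close> below \<open>act y s\<close>. The covering hypothesis excludes the mixed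
  case.\<close>

lemma act_strict_mono:
  assumes x: "x \<in> TI" and y: "y \<in> TI" and s: "s \<in> S"
    and xy: "ble x y" "x \<noteq> y" "act x s \<noteq> y"
    and cov: "\<And>z. \<lbrakk>z \<in> TI; ble x z; ble z y\<rbrakk> \<Longrightarrow> z = x \<or> z = y"
  shows "ble (act x s) (act y s)"
proof (cases "len (x \<otimes> s) < len x")
  case True
  then have "ble (act x s) y" using act_ble_self[of x s] ble_trans assms by blast
  then show ?thesis using ble_act[of "act x s" y s] act_descent[of x s] True assms by blast
next
  case False
  have "\<not> len (y \<otimes> s) < len y"
  proof
    assume "len (y \<otimes> s) < len y"
    then have "ble (act x s) y" using act_ble[of x y s] assms by blast
    \<comment> \<open>Here \<open>act x s\<close> would lie between \<open>x\<close> and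
      \<open>y\<close> while differing from both.\<close>
    then show False
      using cov[of "act x s"] ble_act_self[of x s] False xy act_neq[of x s] x s by blast
  qed
  then have "ble x (act y s)" "len (act y s \<otimes> s) < len (act y s)"
    using ble_act_self[of y s] act_ascent[of y s] ble_trans assms by blast+
  then show ?thesis using act_ble[of x "act y s" s] assms by blast
qed

section \<open>The special matching on the interval\<close>

lemma special_matching_act:
  assumes w: "w \<in> TI" and s: "s \<in> right_descents W S w"
  shows "special_matching
           ((Br_twisted W S \<theta>)\<lparr>carrier := \<lbrace>\<one>..w\<rbrace>\<^bsub>Br_twisted W S \<theta>\<^esub>\<rparr>) (\<lambda>v. act v s)"
proof -
  let ?Q = "(Br_twisted W S \<theta>)\<lparr>carrier := \<lbrace>\<one>..w\<rbrace>\<^bsub>Br_twisted W S \<theta>\<^esub>\<rparr>"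
  have sS: "s \<in> S" and sw: "len (w \<otimes> s) < len w" using s by (auto simp: right_descents_def)
  have car: "x \<in> carrier ?Q \<longleftrightarrow> x \<in> TI \<and> ble \<one> x \<and> ble x w" for x
    by (auto simp: Br_twisted_def at_least_at_most_def)
  have less: "x \<sqsubset>\<^bsub>?Q\<^esub> y \<longleftrightarrow> ble x y \<and> x \<noteq> y" for x y
    by (auto simp: Br_twisted_def lless_def)
  \<comment> \<open>The descent of \<open>w\<close> keeps the image below \<open>w\<close>; it stays
    above \<open>\<one>\<close> because no element is shorter than \<open>\<one>\<close>, so
    \<open>s\<close> is an ascent there.\<close>
  have closed: "act x s \<in> carrier ?Q" if "x \<in> carrier ?Q" for x
    using that act_ble[of x w s] ble_act[of "\<one>" x s] act_TI[of x s] sw sS w one_TI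
    unfolding car len_one by blast
  have cov: "covers ?Q x (act x s)" if x: "x \<in> carrier ?Q" "len (x \<otimes> s) < len x" for x
  proof -
    have "x \<in> TI" using x car by blast
    then show ?thesis
      unfolding covers_def less
      using x closed[OF x(1)] act_ble_self[of x s] act_neq[of x s] no_TI_between_act[of x _ s] sS car
      by blast
  qed
  show ?thesis
    unfolding special_matching_def
  proof (intro conjI ballI impI funcsetI)
    fix x assume x: "x \<in> carrier ?Q"
    then have xT: "x \<in> TI" using car by blast
    show "act x s \<in> carrier ?Q" using closed x .
    show aa: "act (act x s) s = x" using act_act xT sS by blast
    \<comment> \<open>If \<open>s\<close> is not a descent of \<open>x\<close>, it is one of
      \<open>act x s\<close>, and \<open>cov\<close> applies there with the roles exchanged.\<close>
    show "covers ?Q x (act x s) \<or> covers ?Q (act x s) x"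
      using cov[of x] cov[of "act x s"] closed[of x] x act_ascent[of x s] xT sS aa by metis
    fix y assume y: "y \<in> carrier ?Q" and c: "act x s \<noteq> y \<and> covers ?Q y x"
    have yT: "y \<in> TI" using y car by blast
    \<comment> \<open>Intervals are convex, so a cover in \<open>?Q\<close> is also a cover among
      all twisted involutions.\<close>
    have z: "z = x \<or> z = y" if "z \<in> TI" "ble x z" "ble z y" for z
    proof -
      have "z \<in> carrier ?Q" using that x y car ble_trans by blast
      then show ?thesis using c that unfolding covers_def less by blast
    qed
    have "ble x y" "x \<noteq> y" using c unfolding covers_def less by auto
    \<comment> \<open>\<open>act_strict_mono\<close> gives the order relation and
      \<open>act_inj\<close> its strictness.\<close>
    then show "act x s \<sqsubset>\<^bsub>?Q\<^esub> act y s"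
      unfolding less
      using act_strict_mono[of x y s] act_inj[of x y s] z c xT yT sS by blast
  qed
qed

end

theorem theorem4p5:
  fixes W :: "('a, 'b) monoid_scheme" and S :: "'a set" and \<theta> :: "'a \<Rightarrow> 'a" and w s :: 'a
  assumes "coxeter_system W S" and "finite S"
    and "\<theta> \<in> iso W W" and "\<forall>x\<in>carrier W. \<theta> (\<theta> x) = x" and "\<theta> ` S = S"
    and "w \<in> twisted_involutions W \<theta>" and "s \<in> right_descents W S w"
  shows "special_matching
           ((Br_twisted W S \<theta>)\<lparr>carrier := \<lbrace>\<one>\<^bsub>W\<^esub>..w\<rbrace>\<^bsub>Br_twisted W S \<theta>\<^esub>\<rparr>)
           (\<lambda>v. twisted_act W \<theta> v s)"
proof -
  obtain m where "coxeter_matrix S m" "\<forall>xs\<in>lists S. \<forall>ys\<in>lists S.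
           word_prod W xs = word_prod W ys \<longleftrightarrow> equivclp (insert_relator S m) xs ys"
    using assms(1) by (auto simp: coxeter_system_def)
  then have "twisted_coxeter_group W S m \<theta>"
    using assms unfolding twisted_coxeter_group_def twisted_coxeter_group_axioms_def
      coxeter_group_def coxeter_group_axioms_def coxeter_system_def by blast
  then show ?thesis using twisted_coxeter_group.special_matching_act assms by metis
qed

end
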